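(* Let $X\in\mathcal{B}(H^2)$ and let $P_{\langle1\rangle}$ be the orthogonal projection of $H^2$ onto $\langle 1\rangle$. Then $XS=S^*X^*$ if and only if $$X=TP_{\langle1\rangle}+S^*A+BS^*$$ for some $A,B,T\in\mathcal{B}(H^2)$ with $A=A^*$ and $B=B^*$.
   Context: $H^2$ is the (scalar) Hardy–Hilbert space of holomorphic functions $f(z)=\sum_{n\ge0}a_nz^n$ on the unit disk with $\sum|a_n|^2<\infty$; $S$ is the unilateral shift $(Sf)(z)=zf(z)$ on $H^2$; $\mathcal{B}(H^2)$ is the algebra of bounded linear operators on $H^2$; $\langle1\rangle$ is the one-dimensional subspace of constant functions. *)

theory Defs
  imports "HOL-Complex_Analysis.Complex_Analysis"
begin

section \<open>The Hardy--Hilbert space\<close>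

definition taylor_coeff :: "(complex \<Rightarrow> complex) \<Rightarrow> nat \<Rightarrow> complex"
  where "taylor_coeff f n = (deriv ^^ n) f 0 / fact n"

text \<open>A function on the unit disk is represented by a total function that vanishes off the disk,
  so that equality of representatives is equality on the disk.\<close>

definition hardy_space :: "(complex \<Rightarrow> complex) set"
  where "hardy_space = {f. f holomorphic_on ball 0 1 \<and> (\<forall>z. z \<notin> ball 0 1 \<longrightarrow> f z = 0)
    \<and> summable (\<lambda>n. (cmod (taylor_coeff f n))\<^sup>2)}"

lemma taylor_coeff_sums:
  assumes "f holomorphic_on ball 0 1" "z \<in> ball 0 1"
  shows "(\<lambda>n. taylor_coeff f n * z ^ n) sums f z"
  using holomorphic_power_series[OF assms] by (simp add: taylor_coeff_def)

lemma taylor_coeff_unique: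
  assumes "\<And>z. z \<in> ball 0 1 \<Longrightarrow> (\<lambda>n. a n * z ^ n) sums f z"
  shows "taylor_coeff f n = a n"
proof -
  have "eventually (\<lambda>z. z \<in> ball 0 1) (nhds (0::complex))"
    by (intro eventually_nhds_in_open) auto
  then have "eventually (\<lambda>z. (\<lambda>n. fps_nth (Abs_fps a) n * z ^ n) sums f z) (nhds 0)"
    by (rule eventually_mono) (use assms in auto)
  then have "f has_fps_expansion Abs_fps a"
    by (rule has_fps_expansionI)
  from fps_nth_fps_expansion[OF this, of n] show ?thesis
    by (simp add: taylor_coeff_def)
qed

lemma hardy_spaceI:
  assumes "\<And>z. z \<in> ball 0 1 \<Longrightarrow> (\<lambda>n. a n * z ^ n) sums f z"
    and "\<And>z. z \<notin> ball 0 1 \<Longrightarrow> f z = 0" and "summable (\<lambda>n. (cmod (a n))\<^sup>2)"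
  shows "f \<in> hardy_space"
proof -
  have "f holomorphic_on ball 0 1"
    by (rule power_series_holomorphic[where a = a]) (use assms(1) in auto)
  moreover have "taylor_coeff f = a"
    using taylor_coeff_unique[OF assms(1)] by auto
  ultimately show ?thesis
    using assms by (auto simp: hardy_space_def)
qed

lemma summable_square_add:
  fixes a b :: "nat \<Rightarrow> complex"
  assumes "summable (\<lambda>n. (cmod (a n))\<^sup>2)" "summable (\<lambda>n. (cmod (b n))\<^sup>2)"
  shows "summable (\<lambda>n. (cmod (a n + b n))\<^sup>2)"
proof (rule summable_comparison_test)
  show "summable (\<lambda>n. 2 * (cmod (a n))\<^sup>2 + 2 * (cmod (b n))\<^sup>2)"
    by (intro summable_add summable_mult assms)
  have "(cmod (a n + b n))\<^sup>2 \<le> 2 * (cmod (a n))\<^sup>2 + 2 * (cmod (b n))\<^sup>2" for n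
  proof -
    have "(cmod (a n + b n))\<^sup>2 \<le> (cmod (a n) + cmod (b n))\<^sup>2"
      by (intro power_mono norm_triangle_ineq) auto
    also have "\<dots> \<le> 2 * (cmod (a n))\<^sup>2 + 2 * (cmod (b n))\<^sup>2"
      using zero_le_power2[of "cmod (a n) - cmod (b n)"] by (simp add: power2_eq_square algebra_simps)
    finally show ?thesis .
  qed
  then show "\<exists>N. \<forall>n\<ge>N. norm ((cmod (a n + b n))\<^sup>2) \<le> 2 * (cmod (a n))\<^sup>2 + 2 * (cmod (b n))\<^sup>2"
    by auto
qed

lemma summable_square_mult:
  fixes a b :: "nat \<Rightarrow> complex"
  assumes "summable (\<lambda>n. (cmod (a n))\<^sup>2)" "summable (\<lambda>n. (cmod (b n))\<^sup>2)"
  shows "summable (\<lambda>n. a n * cnj (b n))"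
proof (rule summable_comparison_test)
  show "summable (\<lambda>n. (cmod (a n))\<^sup>2 + (cmod (b n))\<^sup>2)"
    by (intro summable_add assms)
  have "cmod (a n) * cmod (b n) \<le> (cmod (a n))\<^sup>2 + (cmod (b n))\<^sup>2" for n
    using sum_squares_bound[of "cmod (a n)" "cmod (b n)"]
      mult_nonneg_nonneg[OF norm_ge_zero[of "a n"] norm_ge_zero[of "b n"]] by linarith
  then show "\<exists>N. \<forall>n\<ge>N. norm (a n * cnj (b n)) \<le> (cmod (a n))\<^sup>2 + (cmod (b n))\<^sup>2"
    by (auto simp: norm_mult)
qed

lemma hardy_space_zero: "(\<lambda>z. 0) \<in> hardy_space"
  by (rule hardy_spaceI[where a = "\<lambda>n. 0"]) auto

lemma hardy_space_add:
  assumes "f \<in> hardy_space" "g \<in> hardy_space"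
  shows "(\<lambda>z. f z + g z) \<in> hardy_space"
  by (rule hardy_spaceI[where a = "\<lambda>n. taylor_coeff f n + taylor_coeff g n"])
    (use assms in \<open>auto simp: hardy_space_def distrib_right
      intro!: sums_add taylor_coeff_sums summable_square_add\<close>)

lemma hardy_space_cmult:
  assumes "f \<in> hardy_space"
  shows "(\<lambda>z. c * f z) \<in> hardy_space"
  by (rule hardy_spaceI[where a = "\<lambda>n. c * taylor_coeff f n"])
    (use assms in \<open>auto simp: hardy_space_def mult.assoc norm_mult power_mult_distrib
      intro!: sums_mult taylor_coeff_sums\<close>)

lemma taylor_coeff_shift_sums:
  assumes "f \<in> hardy_space" "z \<in> ball 0 1"
  shows "(\<lambda>n. (case n of 0 \<Rightarrow> 0 | Suc m \<Rightarrow> taylor_coeff f m) * z ^ n) sums (z * f z)"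
proof -
  have "(\<lambda>n. z * (taylor_coeff f n * z ^ n)) sums (z * f z)"
    using assms by (intro sums_mult taylor_coeff_sums) (auto simp: hardy_space_def)
  then have "(\<lambda>n. (case Suc n of 0 \<Rightarrow> 0 | Suc m \<Rightarrow> taylor_coeff f m) * z ^ Suc n) sums (z * f z)"
    by (simp add: mult_ac)
  then show ?thesis
    by (subst (asm) sums_Suc_iff) simp
qed

lemma hardy_space_shift:
  assumes "f \<in> hardy_space"
  shows "(\<lambda>z. z * f z) \<in> hardy_space"
proof (rule hardy_spaceI[OF taylor_coeff_shift_sums[OF assms]])
  have "summable (\<lambda>n. (cmod (case Suc n of 0 \<Rightarrow> 0 | Suc m \<Rightarrow> taylor_coeff f m))\<^sup>2)"
    using assms by (simp add: hardy_space_def)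
  then show "summable (\<lambda>n. (cmod (case n of 0 \<Rightarrow> 0 | Suc m \<Rightarrow> taylor_coeff f m))\<^sup>2)"
    by (subst (asm) summable_Suc_iff)
qed (use assms in \<open>auto simp: hardy_space_def\<close>)

typedef hardy = hardy_space
  morphisms hardy_fun Abs_hardy
  using hardy_space_zero by blast

setup_lifting type_definition_hardy

lift_definition hcoeff :: "hardy \<Rightarrow> nat \<Rightarrow> complex" is taylor_coeff .

lemma hcoeff_sums: "z \<in> ball 0 1 \<Longrightarrow> (\<lambda>n. hcoeff f n * z ^ n) sums hardy_fun f z"
  by transfer (auto simp: hardy_space_def intro: taylor_coeff_sums)

lemma hcoeff_unique:
  "(\<And>z. z \<in> ball 0 1 \<Longrightarrow> (\<lambda>n. a n * z ^ n) sums hardy_fun f z) \<Longrightarrow> hcoeff f n = a n"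
  by transfer (rule taylor_coeff_unique)

lemma summable_hcoeff: "summable (\<lambda>n. (cmod (hcoeff f n))\<^sup>2)"
  by transfer (simp add: hardy_space_def)

lemma hardy_fun_outside: "z \<notin> ball 0 1 \<Longrightarrow> hardy_fun f z = 0"
  by transfer (auto simp: hardy_space_def)

lemma hardy_eqI:
  assumes "\<And>n. hcoeff f n = hcoeff g n"
  shows "f = g"
proof -
  have "hardy_fun f z = hardy_fun g z" for z
    using hcoeff_sums[of z f] hcoeff_sums[of z g] hardy_fun_outside[of z f] hardy_fun_outside[of z g]
    by (cases "z \<in> ball 0 1") (auto simp: assms dest: sums_unique2)
  then show ?thesis
    by (metis hardy_fun_inject ext)
qed

lemma hardy_of_coeffs:
  assumes "summable (\<lambda>n. (cmod (a n))\<^sup>2)"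
  obtains f where "\<And>n. hcoeff f n = a n"
proof -
  define F where "F = (\<lambda>z. if z \<in> ball 0 1 then \<Sum>n. a n * z ^ n else 0)"
  have bnd: "cmod (a n) \<le> 1 + (\<Sum>n. (cmod (a n))\<^sup>2)" for n
  proof -
    have "(cmod (a n))\<^sup>2 \<le> (\<Sum>n. (cmod (a n))\<^sup>2)"
      using sum_le_suminf[OF assms, of "{n}"] by simp
    moreover have "cmod (a n) \<le> 1 + (cmod (a n))\<^sup>2"
      using zero_le_power2[of "cmod (a n) - 1"] zero_le_power2[of "cmod (a n)"]
      unfolding power2_diff by (smt (verit) norm_ge_zero one_power2 mult.right_neutral)
    ultimately show ?thesis by linarith
  qed
  have *: "(\<lambda>n. a n * z ^ n) sums F z" if "z \<in> ball 0 1" for z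
  proof -
    have "summable (\<lambda>n. a n * z ^ n)"
    proof (rule summable_comparison_test)
      show "summable (\<lambda>n. (1 + (\<Sum>n. (cmod (a n))\<^sup>2)) * cmod z ^ n)"
        using that by (intro summable_mult summable_geometric) auto
      show "\<exists>N. \<forall>n\<ge>N. norm (a n * z ^ n) \<le> (1 + (\<Sum>n. (cmod (a n))\<^sup>2)) * cmod z ^ n"
        by (auto simp: norm_mult norm_power intro!: mult_right_mono bnd)
    qed
    then show ?thesis
      using that by (simp add: F_def summable_sums)
  qed
  have "F \<in> hardy_space"
    by (rule hardy_spaceI[OF *]) (auto simp: F_def assms)
  then have "hcoeff (Abs_hardy F) n = a n" for n
    by (intro hcoeff_unique) (simp add: Abs_hardy_inverse *)
  then show ?thesis by (rule that)
qed

lift_definition scaleC_hardy :: "complex \<Rightarrow> hardy \<Rightarrow> hardy" (infixr "*\<^sub>C" 75)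
  is "\<lambda>c f z. c * f z"
  by (rule hardy_space_cmult)

lemma hcoeff_scaleC [simp]: "hcoeff (c *\<^sub>C f) n = c * hcoeff f n"
  by (rule hcoeff_unique)
    (auto simp: scaleC_hardy.rep_eq mult.assoc intro!: sums_mult hcoeff_sums)

instantiation hardy :: real_vector
begin

lift_definition zero_hardy :: hardy is "\<lambda>z. 0"
  by (rule hardy_space_zero)

lift_definition plus_hardy :: "hardy \<Rightarrow> hardy \<Rightarrow> hardy" is "\<lambda>f g z. f z + g z"
  by (rule hardy_space_add)

lift_definition uminus_hardy :: "hardy \<Rightarrow> hardy" is "\<lambda>f z. - f z"
  using hardy_space_cmult[of _ "-1"] by simp

definition minus_hardy :: "hardy \<Rightarrow> hardy \<Rightarrow> hardy"
  where "minus_hardy f g = f + - g"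

definition scaleR_hardy :: "real \<Rightarrow> hardy \<Rightarrow> hardy"
  where "scaleR_hardy r f = complex_of_real r *\<^sub>C f"

lemma hcoeff_zero: "hcoeff 0 n = 0"
  by (rule hcoeff_unique) (auto simp: zero_hardy.rep_eq)

lemma hcoeff_add: "hcoeff (f + g) n = hcoeff f n + hcoeff g n"
  by (rule hcoeff_unique)
    (auto simp: plus_hardy.rep_eq distrib_right intro!: sums_add hcoeff_sums)

lemma hcoeff_uminus: "hcoeff (- f) n = - hcoeff f n"
  by (rule hcoeff_unique)
    (auto simp: uminus_hardy.rep_eq intro!: sums_minus hcoeff_sums)

lemma hcoeff_scaleR: "hcoeff (r *\<^sub>R f) n = complex_of_real r * hcoeff f n"
  by (simp add: scaleR_hardy_def)

instance
proof
  fix f g h :: hardy and r s :: real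
  show "f + g + h = f + (g + h)" "f + g = g + f" "0 + f = f" "- f + f = 0"
    by (rule hardy_eqI, simp add: hcoeff_add hcoeff_zero hcoeff_uminus)+
  show "f - g = f + - g" by (rule minus_hardy_def)
  show "r *\<^sub>R (f + g) = r *\<^sub>R f + r *\<^sub>R g" "(r + s) *\<^sub>R f = r *\<^sub>R f + s *\<^sub>R f"
    "r *\<^sub>R s *\<^sub>R f = (r * s) *\<^sub>R f" "1 *\<^sub>R f = f"
    by (rule hardy_eqI, simp add: hcoeff_add hcoeff_scaleR algebra_simps)+
qed

end

text \<open>The inner product of the Hardy space, linear in its first argument.\<close>

definition cinner_hardy :: "hardy \<Rightarrow> hardy \<Rightarrow> complex"
  where "cinner_hardy f g = (\<Sum>n. hcoeff f n * cnj (hcoeff g n))"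

lemma summable_cinner: "summable (\<lambda>n. hcoeff f n * cnj (hcoeff g n))"
  by (intro summable_square_mult summable_hcoeff)

lemma cinner_self: "cinner_hardy f f = complex_of_real (\<Sum>n. (cmod (hcoeff f n))\<^sup>2)"
  by (simp add: cinner_hardy_def suminf_of_real[OF summable_hcoeff] flip: complex_norm_square)

lemma cinner_add_left: "cinner_hardy (f + g) h = cinner_hardy f h + cinner_hardy g h"
  by (simp add: cinner_hardy_def hcoeff_add distrib_right suminf_add summable_cinner)

lemma cinner_scaleC_left: "cinner_hardy (c *\<^sub>C f) g = c * cinner_hardy f g"
  by (simp add: cinner_hardy_def mult.assoc suminf_mult summable_cinner)

lemma cinner_commute: "cinner_hardy f g = cnj (cinner_hardy g f)"
  unfolding cinner_hardy_def
  using sums_cnj[THEN iffD2, OF summable_sums[OF summable_cinner[of g f]]]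
  by (simp add: mult.commute sums_iff)

text \<open>The library's inner product spaces are real.  The real inner product is the real part of
  the complex one; it induces the same norm, the square root of the sum of
  the squared moduli of the coefficients.\<close>

instantiation hardy :: real_inner
begin

definition inner_hardy :: "hardy \<Rightarrow> hardy \<Rightarrow> real"
  where "inner_hardy f g = Re (cinner_hardy f g)"

definition norm_hardy :: "hardy \<Rightarrow> real"
  where "norm_hardy f = sqrt (\<Sum>n. (cmod (hcoeff f n))\<^sup>2)"

definition dist_hardy :: "hardy \<Rightarrow> hardy \<Rightarrow> real"
  where "dist_hardy f g = norm (f - g)"

definition sgn_hardy :: "hardy \<Rightarrow> hardy"
  where "sgn_hardy f = f /\<^sub>R norm f"

definition uniformity_hardy :: "(hardy \<times> hardy) filter"
  where "uniformity_hardy = (INF e\<in>{0 <..}. principal {(x, y). dist x y < e})"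

definition open_hardy :: "hardy set \<Rightarrow> bool"
  where "open_hardy U = (\<forall>x\<in>U. \<forall>\<^sub>F (x', y) in uniformity. x' = x \<longrightarrow> y \<in> U)"

instance
proof
  fix f g h :: hardy and r :: real
  show "sgn f = f /\<^sub>R norm f" by (rule sgn_hardy_def)
  show "dist f g = norm (f - g)" by (rule dist_hardy_def)
  show "uniformity = (INF e\<in>{0 <..}. principal {(x, y :: hardy). dist x y < e})"
    by (rule uniformity_hardy_def)
  show "open U = (\<forall>x\<in>U. \<forall>\<^sub>F (x', y) in uniformity. x' = x \<longrightarrow> y \<in> U)" for U :: "hardy set"
    by (rule open_hardy_def)
  show "inner f g = inner g f"
    unfolding inner_hardy_def by (subst cinner_commute) simp
  show "inner (f + g) h = inner f h + inner g h"
    by (simp add: inner_hardy_def cinner_add_left)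
  show "inner (r *\<^sub>R f) g = r * inner f g"
    by (simp add: inner_hardy_def scaleR_hardy_def cinner_scaleC_left)
  show "0 \<le> inner f f"
    by (simp add: inner_hardy_def cinner_self suminf_nonneg summable_hcoeff)
  have "f = 0" if "(\<Sum>n. (cmod (hcoeff f n))\<^sup>2) = 0"
    using that by (intro hardy_eqI) (simp add: hcoeff_zero suminf_eq_zero_iff[OF summable_hcoeff])
  then show "inner f f = 0 \<longleftrightarrow> f = 0"
    by (auto simp: inner_hardy_def cinner_self hcoeff_zero)
  show "norm f = sqrt (inner f f)"
    by (simp add: norm_hardy_def inner_hardy_def cinner_self)
qed

end

lemma summable_of_finite_support:
  "(\<And>n. n \<ge> N \<Longrightarrow> a n = 0) \<Longrightarrow> summable (\<lambda>n. (cmod (a n))\<^sup>2)"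
  by (rule summable_finite[of "{..<N}"]) auto

lemma norm_hardy_sq: "(norm f)\<^sup>2 = (\<Sum>n. (cmod (hcoeff f n))\<^sup>2)" for f :: hardy
  by (simp add: norm_hardy_def suminf_nonneg summable_hcoeff)

lemma norm_scaleC: "norm (c *\<^sub>C f) = cmod c * norm f"
  by (simp add: norm_hardy_def norm_mult power_mult_distrib suminf_mult summable_hcoeff real_sqrt_mult)

lemma cinner_Cauchy_Schwarz: "cmod (cinner_hardy f g) \<le> norm f * norm g"
proof (cases "cinner_hardy f g = 0")
  case False
  define u where "u = cnj (cinner_hardy f g) / cmod (cinner_hardy f g)"
  have "cinner_hardy (u *\<^sub>C f) g = cmod (cinner_hardy f g)"
    using False complex_norm_square[of "cinner_hardy f g"]
    by (simp add: cinner_scaleC_left u_def power2_eq_square field_simps)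
  then have "cmod (cinner_hardy f g) = inner (u *\<^sub>C f) g"
    by (simp add: inner_hardy_def)
  also have "\<dots> \<le> norm (u *\<^sub>C f) * norm g"
    by (rule norm_cauchy_schwarz)
  also have "norm (u *\<^sub>C f) = norm f"
    using False by (simp add: norm_scaleC u_def norm_divide)
  finally show ?thesis .
qed simp

lemma cinner_diff_left: "cinner_hardy (f - g) h = cinner_hardy f h - cinner_hardy g h"
  using cinner_add_left[of "f - g" g h] by simp

lemma hcoeff_diff: "hcoeff (f - g) n = hcoeff f n - hcoeff g n"
  using hcoeff_add[of "f - g" g n] by simp

section \<open>Operators\<close>

text \<open>The library's \<^const>\<open>bounded_linear\<close> only demands linearity over the reals.\<close>

definition bounded_ops :: "(hardy \<Rightarrow> hardy) set"
  where "bounded_ops = {X. bounded_linear X \<and> (\<forall>c f. X (c *\<^sub>C f) = c *\<^sub>C X f)}"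

text \<open>The description determines a function for every bounded operator, see \<open>hadjoint_works\<close> and
  \<open>hadjoint_unique\<close> below.\<close>

definition hadjoint :: "(hardy \<Rightarrow> hardy) \<Rightarrow> (hardy \<Rightarrow> hardy)"
  where "hadjoint X = (THE Y. \<forall>f g. cinner_hardy (X f) g = cinner_hardy f (Y g))"

lemma hadjoint_unique:
  assumes "\<And>f g. cinner_hardy (X f) g = cinner_hardy f (Y g)"
  shows "hadjoint X = Y"
  unfolding hadjoint_def
proof (rule the_equality)
  fix Y' assume Y': "\<forall>f g. cinner_hardy (X f) g = cinner_hardy f (Y' g)"
  show "Y' = Y"
  proof
    fix g
    have "cinner_hardy f (Y' g) = cinner_hardy f (Y g)" for f
      using Y' assms by metis
    then have "inner (Y' g - Y g) (Y' g) = inner (Y' g - Y g) (Y g)"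
      by (simp add: inner_hardy_def)
    then have "inner (Y' g - Y g) (Y' g - Y g) = 0"
      by (simp add: inner_diff_right)
    then show "Y' g = Y g" by simp
  qed
qed (use assms in auto)

lemma hadjoint_exists:
  assumes "X \<in> bounded_ops"
  shows "\<exists>h. \<forall>f. cinner_hardy (X f) g = cinner_hardy f h"
proof -
  interpret X: bounded_linear X using assms by (simp add: bounded_ops_def)
  have XC: "X (c *\<^sub>C f) = c *\<^sub>C X f" for c f using assms by (simp add: bounded_ops_def)
  obtain K where K: "K \<ge> 0" "\<And>f. norm (X f) \<le> norm f * K" using X.nonneg_bounded by blast
  have "\<exists>f. \<forall>k. hcoeff f k = (if k = n then 1 else 0)" for n
    using hardy_of_coeffs[OF summable_of_finite_support[of "Suc n" "\<lambda>k. if k = n then 1 else 0"]]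
    by (metis Suc_n_not_le_n)
  then obtain e where e: "\<And>n k. hcoeff (e n) k = (if k = n then 1 else 0)" by metis
  define c where "c n = cnj (cinner_hardy (X (e n)) g)" for n
  define P where "P a N = (\<Sum>n<N. a n *\<^sub>C e n)" for a N
  have hP: "hcoeff (P a N) k = (if k < N then a k else 0)" for a N k
    unfolding P_def
    by (induction N) (auto simp: hcoeff_add hcoeff_zero e less_Suc_eq)
  have XP: "cinner_hardy (X (P a N)) g = (\<Sum>n<N. a n * cnj (c n))" for a N
    unfolding P_def
    by (induction N) (auto simp: X.add X.zero XC cinner_add_left cinner_scaleC_left c_def cinner_hardy_def[of 0] hcoeff_zero)
  have "summable (\<lambda>n. (cmod (c n))\<^sup>2)"
  proof (rule bounded_imp_summable)
    fix N
    define s where "s = (\<Sum>n<Suc N. (cmod (c n))\<^sup>2)"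
    have s0: "s \<ge> 0" by (simp add: s_def sum_nonneg)
    have "(norm (P c (Suc N)))\<^sup>2 = s"
      unfolding norm_hardy_sq hP s_def
      by (subst suminf_finite[of "{..<Suc N}"]) auto
    then have nP: "norm (P c (Suc N)) = sqrt s" by (metis norm_ge_zero real_sqrt_unique)
    have "s = cmod (cinner_hardy (X (P c (Suc N))) g)"
      unfolding XP s_def using s0
      by (simp add: s_def flip: complex_norm_square of_real_sum of_real_power of_real_add del: sum.lessThan_Suc)
    also have "\<dots> \<le> norm (X (P c (Suc N))) * norm g" by (rule cinner_Cauchy_Schwarz)
    also have "\<dots> \<le> sqrt s * K * norm g"
      using K(2)[of "P c (Suc N)"] nP by (intro mult_right_mono) auto
    finally have *: "sqrt s * sqrt s \<le> sqrt s * (K * norm g)" using s0 by (simp add: mult.assoc)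
    have "sqrt s \<le> K * norm g"
    proof (cases "s = 0")
      case False
      then show ?thesis using s0 mult_left_le_imp_le[OF *] by simp
    qed (use K in auto)
    then have "(sqrt s)\<^sup>2 \<le> (K * norm g)\<^sup>2" using s0 by (intro power_mono) auto
    then show "(\<Sum>n\<le>N. (cmod (c n))\<^sup>2) \<le> (K * norm g)\<^sup>2"
      using s0 by (simp add: s_def lessThan_Suc_atMost)
  qed auto
  then obtain h where h: "\<And>n. hcoeff h n = c n" using hardy_of_coeffs by blast
  have "cinner_hardy (X f) g = cinner_hardy f h" for f
  proof (rule LIMSEQ_unique)
    let ?p = "\<lambda>N. P (hcoeff f) N"
    show "(\<lambda>N. cinner_hardy (X (?p N)) g) \<longlonglongrightarrow> cinner_hardy f h"
      unfolding XP using summable_LIMSEQ[OF summable_cinner[of f h]]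
      by (simp add: h cinner_hardy_def)
    have "(norm (f - ?p N))\<^sup>2 = (norm f)\<^sup>2 - (\<Sum>n<N. (cmod (hcoeff f n))\<^sup>2)" for N
    proof -
      have "(norm (f - ?p N))\<^sup>2 = (\<Sum>n. (cmod (hcoeff (f - ?p N) (n + N)))\<^sup>2)"
        unfolding norm_hardy_sq
        by (subst suminf_split_initial_segment[OF summable_hcoeff, of _ N]) (simp add: hcoeff_diff hP)
      then show ?thesis
        unfolding norm_hardy_sq
        by (subst suminf_split_initial_segment[OF summable_hcoeff, of f N]) (simp add: hcoeff_diff hP)
    qed
    moreover have "(\<lambda>N. (norm f)\<^sup>2 - (\<Sum>n<N. (cmod (hcoeff f n))\<^sup>2)) \<longlonglongrightarrow> (norm f)\<^sup>2 - (norm f)\<^sup>2"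
      unfolding norm_hardy_sq by (intro tendsto_intros summable_LIMSEQ summable_hcoeff)
    ultimately have "(\<lambda>N. (norm (f - ?p N))\<^sup>2) \<longlonglongrightarrow> 0" by simp
    then have "(\<lambda>N. sqrt ((norm (f - ?p N))\<^sup>2)) \<longlonglongrightarrow> 0" using tendsto_real_sqrt by force
    then have lim: "(\<lambda>N. norm (f - ?p N)) \<longlonglongrightarrow> 0" by simp
    have "(\<lambda>N. cinner_hardy (X f) g - cinner_hardy (X (?p N)) g) \<longlonglongrightarrow> 0"
    proof (rule Lim_null_comparison)
      show "\<forall>\<^sub>F N in sequentially. cmod (cinner_hardy (X f) g - cinner_hardy (X (?p N)) g)
          \<le> norm (f - ?p N) * (K * norm g)"
      proof (rule always_eventually, rule allI)
        fix N
        have "cmod (cinner_hardy (X f) g - cinner_hardy (X (?p N)) g) \<le> norm (X (f - ?p N)) * norm g"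
          using cinner_Cauchy_Schwarz[of "X (f - ?p N)" g] by (simp add: X.diff cinner_diff_left)
        also have "\<dots> \<le> (norm (f - ?p N) * K) * norm g" by (intro mult_right_mono K) auto
        finally show "cmod (cinner_hardy (X f) g - cinner_hardy (X (?p N)) g) \<le> norm (f - ?p N) * (K * norm g)"
          by (simp add: mult.assoc)
      qed
      show "(\<lambda>N. norm (f - ?p N) * (K * norm g)) \<longlonglongrightarrow> 0"
        using tendsto_mult_right[OF lim] by simp
    qed
    from tendsto_diff[OF tendsto_const[of "cinner_hardy (X f) g"] this]
    show "(\<lambda>N. cinner_hardy (X (?p N)) g) \<longlonglongrightarrow> cinner_hardy (X f) g" by simp
  qed
  then show ?thesis by blast
qed

lemma hadjoint_works:
  assumes "X \<in> bounded_ops"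
  shows "cinner_hardy (X f) g = cinner_hardy f (hadjoint X g)"
proof -
  obtain Y where "\<And>f g. cinner_hardy (X f) g = cinner_hardy f (Y g)"
    using hadjoint_exists[OF assms] by metis
  then show ?thesis using hadjoint_unique by metis
qed

lift_definition shift :: "hardy \<Rightarrow> hardy" is "\<lambda>f z. z * f z"
  by (rule hardy_space_shift)

lemma hcoeff_shift: "hcoeff (shift f) n = (case n of 0 \<Rightarrow> 0 | Suc m \<Rightarrow> hcoeff f m)"
  by transfer (auto intro: taylor_coeff_unique taylor_coeff_shift_sums)

definition constants :: "hardy set"
  where "constants = {f. \<exists>c. \<forall>z\<in>ball 0 1. hardy_fun f z = c}"

lemma constants_iff: "f \<in> constants \<longleftrightarrow> (\<forall>n>0. hcoeff f n = 0)"
proof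
  assume "f \<in> constants"
  then obtain c where c: "\<And>z. z \<in> ball 0 1 \<Longrightarrow> hardy_fun f z = c" by (auto simp: constants_def)
  have "hcoeff f n = (if n = 0 then c else 0)" for n
  proof (rule hcoeff_unique)
    fix z :: complex assume "z \<in> ball 0 1"
    have "(\<lambda>n. (if n = 0 then c else 0) * z ^ n) = (\<lambda>n. if n = 0 then c * z ^ n else 0)" by auto
    then show "(\<lambda>n. (if n = 0 then c else 0) * z ^ n) sums hardy_fun f z"
      using c[OF \<open>z \<in> ball 0 1\<close>] sums_single[of 0 "\<lambda>n. c * z ^ n"] by simp
  qed
  then show "\<forall>n>0. hcoeff f n = 0" by simp
next
  assume *: "\<forall>n>0. hcoeff f n = 0"
  have "hardy_fun f z = hcoeff f 0" if "z \<in> ball 0 1" for z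
  proof -
    have "(\<lambda>n. hcoeff f n * z ^ n) = (\<lambda>n. if n = 0 then hcoeff f n * z ^ n else 0)" using * by auto
    then show ?thesis using sums_single[of 0 "\<lambda>n. hcoeff f n * z ^ n"] hcoeff_sums[OF that, of f] sums_unique2
      by fastforce
  qed
  then show "f \<in> constants" by (auto simp: constants_def)
qed

text \<open>The orthogonal projection onto \<open>M\<close>, meaningful for closed complex subspaces \<open>M\<close>.\<close>

definition orth_proj :: "hardy set \<Rightarrow> hardy \<Rightarrow> hardy"
  where "orth_proj M f = (THE p. p \<in> M \<and> (\<forall>m\<in>M. cinner_hardy (f - p) m = 0))"

lemma hcoeff_orth_proj_constants:
  "hcoeff (orth_proj constants f) n = (if n = 0 then hcoeff f 0 else 0)"
proof -
  obtain p where p: "\<And>n. hcoeff p n = (if n = 0 then hcoeff f 0 else 0)"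
    by (rule hardy_of_coeffs[of "\<lambda>n. if n = 0 then hcoeff f 0 else 0"])
      (auto intro: summable_of_finite_support[of 1])
  have ci: "cinner_hardy h m = hcoeff h 0 * cnj (hcoeff m 0)" if "m \<in> constants" for h m
    unfolding cinner_hardy_def using that by (subst suminf_finite[of "{0}"]) (auto simp: constants_iff)
  have "orth_proj constants f = p"
    unfolding orth_proj_def
  proof (rule the_equality)
    show "p \<in> constants \<and> (\<forall>m\<in>constants. cinner_hardy (f - p) m = 0)"
      by (auto simp: ci hcoeff_diff p constants_iff[of p])
    fix q assume q: "q \<in> constants \<and> (\<forall>m\<in>constants. cinner_hardy (f - q) m = 0)"
    have "p \<in> constants" by (auto simp: p constants_iff)
    then have "(hcoeff f 0 - hcoeff q 0) * cnj (hcoeff f 0) = 0"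
         "(hcoeff f 0 - hcoeff q 0) * cnj (hcoeff q 0) = 0"
      using q ci by (auto simp: hcoeff_diff p)
    then have "hcoeff q 0 = hcoeff f 0" by auto
    then show "q = p" using q by (intro hardy_eqI) (auto simp: p constants_iff)
  qed
  then show ?thesis by (simp add: p)
qed

end

(* Put P for the projection onto the constants. From S* S = 1, P S = 0 and P + S S* = 1 one gets
   X = X P + (X S) S*, and for X = T P + S* A + B S* one gets X S = S* A S + B. The equation
   X S = S* X* says precisely that X S is self-adjoint, so in one direction
   T = X, A = 0, B = X S works and in the other S* A S + B is visibly self-adjoint. *)

theory Submission
  imports Defs
begin

lemma cinner_add_right: "cinner_hardy h (f + g) = cinner_hardy h f + cinner_hardy h g"
  by (metis cinner_add_left cinner_commute complex_cnj_add)

lemma shift_bounded_op: "shift \<in> bounded_ops"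
proof -
  have "bounded_linear shift"
  proof (rule bounded_linear_intro[where K = 1])
    show "shift (f + g) = shift f + shift g" for f g
      by (rule hardy_eqI) (simp add: hcoeff_shift hcoeff_add split: nat.split)
    show "shift (r *\<^sub>R f) = r *\<^sub>R shift f" for r f
      by (rule hardy_eqI) (simp add: hcoeff_shift hcoeff_scaleR split: nat.split)
    \<comment> \<open>The coefficient of \<open>shift f\<close> at 0 vanishes, so splitting it off
      leaves the sum for \<open>f\<close>: the shift is even an isometry.\<close>
    show "norm (shift f) \<le> norm f * 1" for f
      using suminf_split_head[OF summable_hcoeff[of "shift f"]]
      by (simp add: norm_hardy_def hcoeff_shift)
  qed
  moreover have "shift (c *\<^sub>C f) = c *\<^sub>C shift f" for c f
    by (rule hardy_eqI) (simp add: hcoeff_shift split: nat.split)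
  ultimately show ?thesis
    by (simp add: bounded_ops_def)
qed

text \<open>The backward shift \<open>L\<close> on coefficients satisfies the identity that
  characterises the adjoint, because the term at index 0 of the inner product with
  \<open>shift f\<close> is zero.\<close>

lemma hcoeff_hadjoint_shift: "hcoeff (hadjoint shift g) n = hcoeff g (Suc n)"
proof -
  have "\<exists>h. \<forall>n. hcoeff h n = hcoeff g (Suc n)" for g
    using hardy_of_coeffs[of "\<lambda>n. hcoeff g (Suc n)"] summable_hcoeff[of g]
    by (metis (no_types, lifting) summable_Suc_iff[of "\<lambda>n. (cmod (hcoeff g n))\<^sup>2"])
  then obtain L where L: "\<And>g n. hcoeff (L g) n = hcoeff g (Suc n)"
    by metis
  have "cinner_hardy (shift f) g = cinner_hardy f (L g)" for f g
    using suminf_split_head[OF summable_cinner[of "shift f" g]]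
    by (simp add: cinner_hardy_def hcoeff_shift L)
  then have "hadjoint shift = L"
    by (rule hadjoint_unique)
  then show ?thesis
    by (simp add: L)
qed

lemma hadjoint_shift_shift: "hadjoint shift (shift f) = f"
  by (rule hardy_eqI) (simp add: hcoeff_hadjoint_shift hcoeff_shift)

lemma orth_proj_constants_shift: "orth_proj constants (shift f) = 0"
  by (rule hardy_eqI) (simp add: hcoeff_orth_proj_constants hcoeff_shift hcoeff_zero)

text \<open>Shifting back and forth loses exactly the coefficient at 0, which the projection
  restores.\<close>

lemma orth_proj_constants_add_shift:
  "orth_proj constants f + shift (hadjoint shift f) = f"
  by (rule hardy_eqI)
    (simp add: hcoeff_add hcoeff_orth_proj_constants hcoeff_shift hcoeff_hadjoint_shift
      split: nat.split)

text \<open>Conjugate symmetry turns \<open>hadjoint_works\<close> around, so that an adjoint in the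
  left argument can be moved too.\<close>

lemma hadjoint_left:
  assumes "X \<in> bounded_ops"
  shows "cinner_hardy (hadjoint X f) g = cinner_hardy f (X g)"
  by (metis assms cinner_commute hadjoint_works)

lemma bounded_ops_comp:
  assumes "X \<in> bounded_ops" "Y \<in> bounded_ops"
  shows "X \<circ> Y \<in> bounded_ops"
  using assms bounded_linear_compose[of X Y] by (simp add: bounded_ops_def comp_def)

lemma hadjoint_comp:
  assumes "X \<in> bounded_ops" "Y \<in> bounded_ops"
  shows "hadjoint (X \<circ> Y) = hadjoint Y \<circ> hadjoint X"
  by (rule hadjoint_unique) (simp add: assms hadjoint_works)

lemma zero_bounded_op: "(\<lambda>f. 0) \<in> bounded_ops"
  by (auto simp: bounded_ops_def hcoeff_zero intro: hardy_eqI)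

lemma hadjoint_zero: "hadjoint (\<lambda>f. 0) = (\<lambda>f. 0)"
  by (rule hadjoint_unique) (simp add: cinner_hardy_def hcoeff_zero)

theorem theorem3p4:
  fixes X :: "hardy \<Rightarrow> hardy"
  assumes "X \<in> bounded_ops"
  shows "X \<circ> shift = hadjoint shift \<circ> hadjoint X \<longleftrightarrow>
    (\<exists>A\<in>bounded_ops. \<exists>B\<in>bounded_ops. \<exists>T\<in>bounded_ops.
      A = hadjoint A \<and> B = hadjoint B \<and>
      X = (\<lambda>f. T (orth_proj constants f) + hadjoint shift (A f) + B (hadjoint shift f)))"
    (is "?L \<longleftrightarrow> ?R")
proof
  assume ?L
  \<comment> \<open>By \<open>hadjoint_comp\<close> the right-hand side of the equation is the
    adjoint of its left-hand side.\<close>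
  then have "X \<circ> shift = hadjoint (X \<circ> shift)"
    using hadjoint_comp[OF assms shift_bounded_op] by (rule trans[OF _ sym])
  \<comment> \<open>The term \<open>hadjoint shift 0\<close> is kept so that the formula has the
    required shape with A the zero operator.\<close>
  moreover have "X = (\<lambda>f. X (orth_proj constants f) + hadjoint shift 0 + (X \<circ> shift) (hadjoint shift f))"
  proof
    fix f
    have "hadjoint shift 0 = 0"
      by (rule hardy_eqI) (simp add: hcoeff_hadjoint_shift hcoeff_zero)
    moreover have "X (g + h) = X g + X h" for g h
      using assms by (simp add: bounded_ops_def linear_simps)
    ultimately show "X f = X (orth_proj constants f) + hadjoint shift 0 + (X \<circ> shift) (hadjoint shift f)"
      by (simp flip: \<open>\<And>g h. X (g + h) = X g + X h\<close> add: orth_proj_constants_add_shift)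
  qed
  ultimately show ?R
    by (intro bexI[of _ "\<lambda>f. 0"] bexI[of _ "X \<circ> shift"] bexI[of _ X] conjI)
      (rule hadjoint_zero[symmetric] zero_bounded_op assms bounded_ops_comp[OF assms shift_bounded_op]
        | assumption)+
next
  assume ?R
  then obtain A B T where ops: "A \<in> bounded_ops" "B \<in> bounded_ops" "T \<in> bounded_ops"
    and adj: "A = hadjoint A" "B = hadjoint B"
    and X: "X = (\<lambda>f. T (orth_proj constants f) + hadjoint shift (A f) + B (hadjoint shift f))"
    by blast
  \<comment> \<open>The projection kills the range of the shift, so \<open>T\<close> only meets the
    zero vector in X S.\<close>
  have "T 0 = 0"
    using ops(3) by (simp add: bounded_ops_def linear_simps)
  then have XS: "(X \<circ> shift) f = hadjoint shift (A (shift f)) + B f" for f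
    by (simp add: X orth_proj_constants_shift hadjoint_shift_shift)
  have "cinner_hardy (A f) g = cinner_hardy f (A g)" "cinner_hardy (B f) g = cinner_hardy f (B g)"
    for f g
    using ops adj by (metis hadjoint_works)+
  \<comment> \<open>Both inner products of the S* A S part reduce to \<langle>S f, A S g\<rangle>;
    the B part is symmetric already.\<close>
  then have "hadjoint (X \<circ> shift) = X \<circ> shift"
    by (intro hadjoint_unique)
      (simp only: XS cinner_add_left cinner_add_right hadjoint_left[OF shift_bounded_op]
        flip: hadjoint_works[OF shift_bounded_op])
  then show ?L
    by (simp add: hadjoint_comp assms shift_bounded_op)
qed

end
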